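(* Assume a finite relational vocabulary. Let $\mathfrak M,\mathfrak N$ be $\mathsf{FO(TC^1)}$-Henkin structures, $\bar a\in dom(\mathfrak M)^s$, $\bar b\in dom(\mathfrak N)^s$, $s\ge0$, $n\ge0$. Spoiler has a winning strategy in the game $EF^n_{\mathsf{FO(TC^1)}}((\mathfrak M,\bar a),(\mathfrak N,\bar b))$ if and only if there is an $\mathsf{FO(TC^1)}$-formula of quantifier depth $n$ distinguishing $(\mathfrak M,\bar a)$ and $(\mathfrak N,\bar b)$ (i.e. true of $\bar a$ in $\mathfrak M$ and false of $\bar b$ in $\mathfrak N$, or vice versa).
   Context: $\mathsf{FO(TC^1)}$ extends first-order logic with formulas $[TC_{xy}\varphi](u,v)$; quantifier depth counts nested first-order quantifiers and $TC$ operators. Henkin semantics: a frame is a relational structure with a set $\mathbb A_{\mathfrak M}$ of admissible subsets; $[TC_{xy}\varphi](u,v)$ holds under $g$ iff for all $A\in\mathbb A_{\mathfrak M}$, if $g(u)\in A$ and for all $a,b$ ($a\in A$ and $\mathfrak M,g[a/x,b/y]\models\varphi$ imply $b\in A$), then $g(v)\in A$. An $\mathsf{FO(TC^1)}$-Henkin structure is a frame containing every set $\{a:\mathfrak M,g[a/x]\models\varphi\}$ ($\varphi$ an $\mathsf{FO(TC^1)}$-formula, $g$ an assignment) among its admissible sets. A finite partial isomorphism between $\mathfrak M$ and $\mathfrak N$ is a finite relation $\{(a_1,b_1),\ldots,(a_m,b_m)\}$ such that for all atomic $\varphi(x_1,\ldots,x_m)$, $\mathfrak M\models\varphi[a_1,\ldots,a_m]$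 iff $\mathfrak N\models\varphi[b_1,\ldots,b_m]$. The game $EF^n_{\mathsf{FO(TC^1)}}((\mathfrak M,\bar a),(\mathfrak N,\bar b))$ has $n$ rounds between Spoiler and Duplicator, starting from the pairing $\bar a\mapsto\bar b$. In each round Spoiler chooses one of two moves. ∃-move: Spoiler picks an element in one structure and Duplicator picks an element in the other; the pair is added. TC-move: Spoiler selects two pebble pairs $(a_i,b_i),(a_j,b_j)$ already on the board and either (a) picks $A\in\mathbb A_{\mathfrak M}$ with $a_i\in A$, $a_j\notin A$; Duplicator answers $B\in\mathbb A_{\mathfrak N}$ with $b_i\in B$, $b_j\notin B$; Spoiler picks $b'\in B$, $b''\notin B$; Duplicator answers $a'\in A$, $a''\notin A$; or (b) symmetrically, picks $B\in\mathbb A_{\mathfrak N}$ with $b_i\in B$, $b_j\notin B$; Duplicator answers $A\in\mathbb A_{\mathfrak M}$ with $a_i\in A$, $a_j\notin A$; Spoiler picks $a'\in A$, $a''\notin A$; Duplicator answers $b'\in B$, $b''\notin B$. In a TC-move the pairs $(a',b'),(a'',b'')$ are added and the sets are forgotten. Duplicator wins if after the $n$ rounds the constructed pairing is a finite partial isomorphism; otherwise Spoiler wins. *)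

theory Defs
  imports Main
begin

section \<open>Vocabularies, frames and formulas\<close>

record 'r vocab =
  syms :: "'r set"
  arity :: "'r \<Rightarrow> nat"

record ('r, 'a) frame =
  univ :: "'a set"
  rel :: "'r \<Rightarrow> 'a list set"
  adm :: "'a set set"

definition is_frame :: "'r vocab \<Rightarrow> ('r, 'a) frame \<Rightarrow> bool" where
  "is_frame V M \<longleftrightarrow>
     univ M \<noteq> {} \<and>
     (\<forall>R\<in>syms V. rel M R \<subseteq> {xs. length xs = arity V R \<and> set xs \<subseteq> univ M}) \<and>
     adm M \<subseteq> Pow (univ M)"

text \<open>Variables are natural numbers. The remaining connectives and the universal quantifier are
  the usual abbreviations; they do not affect quantifier depth.\<close>

datatype 'r fm =
    Eq nat nat
  | Rel 'r "nat list"
  | Neg "'r fm"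
  | Conj "'r fm" "'r fm"
  | Ex nat "'r fm"
  | TC nat nat "'r fm" nat nat  \<comment> \<open>\<open>TC x y \<phi> u v\<close> is \<open>[TC\<^sub>x\<^sub>y \<phi>](u,v)\<close>\<close>

primrec wf_fm :: "'r vocab \<Rightarrow> 'r fm \<Rightarrow> bool" where
  "wf_fm V (Eq u v) \<longleftrightarrow> True"
| "wf_fm V (Rel R us) \<longleftrightarrow> R \<in> syms V \<and> length us = arity V R"
| "wf_fm V (Neg \<phi>) \<longleftrightarrow> wf_fm V \<phi>"
| "wf_fm V (Conj \<phi> \<psi>) \<longleftrightarrow> wf_fm V \<phi> \<and> wf_fm V \<psi>"
| "wf_fm V (Ex x \<phi>) \<longleftrightarrow> wf_fm V \<phi>"
| "wf_fm V (TC x y \<phi> u v) \<longleftrightarrow> x \<noteq> y \<and> wf_fm V \<phi>"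

primrec fv :: "'r fm \<Rightarrow> nat set" where
  "fv (Eq u v) = {u, v}"
| "fv (Rel R us) = set us"
| "fv (Neg \<phi>) = fv \<phi>"
| "fv (Conj \<phi> \<psi>) = fv \<phi> \<union> fv \<psi>"
| "fv (Ex x \<phi>) = fv \<phi> - {x}"
| "fv (TC x y \<phi> u v) = (fv \<phi> - {x, y}) \<union> {u, v}"

primrec qdepth :: "'r fm \<Rightarrow> nat" where
  "qdepth (Eq u v) = 0"
| "qdepth (Rel R us) = 0"
| "qdepth (Neg \<phi>) = qdepth \<phi>"
| "qdepth (Conj \<phi> \<psi>) = max (qdepth \<phi>) (qdepth \<psi>)"
| "qdepth (Ex x \<phi>) = Suc (qdepth \<phi>)"
| "qdepth (TC x y \<phi> u v) = Suc (qdepth \<phi>)"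

primrec atomic :: "'r fm \<Rightarrow> bool" where
  "atomic (Eq u v) \<longleftrightarrow> True"
| "atomic (Rel R us) \<longleftrightarrow> True"
| "atomic (Neg \<phi>) \<longleftrightarrow> False"
| "atomic (Conj \<phi> \<psi>) \<longleftrightarrow> False"
| "atomic (Ex x \<phi>) \<longleftrightarrow> False"
| "atomic (TC x y \<phi> u v) \<longleftrightarrow> False"

section \<open>Henkin semantics\<close>

primrec sat :: "('r, 'a) frame \<Rightarrow> (nat \<Rightarrow> 'a) \<Rightarrow> 'r fm \<Rightarrow> bool" where
  "sat M g (Eq u v) \<longleftrightarrow> g u = g v"
| "sat M g (Rel R us) \<longleftrightarrow> map g us \<in> rel M R"
| "sat M g (Neg \<phi>) \<longleftrightarrow> \<not> sat M g \<phi>"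
| "sat M g (Conj \<phi> \<psi>) \<longleftrightarrow> sat M g \<phi> \<and> sat M g \<psi>"
| "sat M g (Ex x \<phi>) \<longleftrightarrow> (\<exists>a\<in>univ M. sat M (g(x := a)) \<phi>)"
| "sat M g (TC x y \<phi> u v) \<longleftrightarrow>
     (\<forall>A\<in>adm M.
        g u \<in> A \<and>
        (\<forall>a\<in>univ M. \<forall>b\<in>univ M. a \<in> A \<and> sat M (g(x := a, y := b)) \<phi> \<longrightarrow> b \<in> A)
        \<longrightarrow> g v \<in> A)"

definition henkin_structure :: "'r vocab \<Rightarrow> ('r, 'a) frame \<Rightarrow> bool" where
  "henkin_structure V M \<longleftrightarrow>
     is_frame V M \<and>
     (\<forall>\<phi> g x. wf_fm V \<phi> \<and> range g \<subseteq> univ M \<longrightarrow> {a \<in> univ M. sat M (g(x := a)) \<phi>} \<in> adm M)"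

text \<open>A tuple is a list whose \<open>i\<close>-th entry (from \<open>0\<close>) is the value of variable \<open>i\<close>. The predicate
  below is used only for formulas whose free variables are below the length of the tuple, so that
  the choice of the assignment \<open>g\<close> extending the tuple is immaterial.\<close>

definition true_of :: "('r, 'a) frame \<Rightarrow> 'a list \<Rightarrow> 'r fm \<Rightarrow> bool" where
  "true_of M as \<phi> \<longleftrightarrow>
     (\<forall>g. range g \<subseteq> univ M \<and> (\<forall>i<length as. g i = as ! i) \<longrightarrow> sat M g \<phi>)"

definition distinguishes ::
  "'r fm \<Rightarrow> ('r, 'a) frame \<Rightarrow> 'a list \<Rightarrow> ('r, 'b) frame \<Rightarrow> 'b list \<Rightarrow> bool" where
  "distinguishes \<phi> M as N bs \<longleftrightarrow>
     (true_of M as \<phi> \<and> \<not> true_of N bs \<phi>) \<or> (\<not> true_of M as \<phi> \<and> true_of N bs \<phi>)"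

section \<open>The game\<close>

text \<open>The board, a finite pairing of elements of \<open>M\<close> and \<open>N\<close>, is kept as the list of its pairs in
  the order in which they were added.\<close>

definition partial_iso ::
  "'r vocab \<Rightarrow> ('r, 'a) frame \<Rightarrow> ('r, 'b) frame \<Rightarrow> ('a \<times> 'b) list \<Rightarrow> bool" where
  "partial_iso V M N ps \<longleftrightarrow>
     set ps \<subseteq> univ M \<times> univ N \<and>
     (\<forall>\<phi>. wf_fm V \<phi> \<and> atomic \<phi> \<and> fv \<phi> \<subseteq> {..<length ps} \<longrightarrow>
        (true_of M (map fst ps) \<phi> \<longleftrightarrow> true_of N (map snd ps) \<phi>))"

text \<open>What has happened so far in the current round. In the constructors for the TC-move,
  \<open>TcM\<close> stands for variant (a), where Spoiler first picks a set in \<open>M\<close>, and \<open>TcN\<close> for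
  variant (b).\<close>

datatype ('a, 'b) phase =
    Begin                               \<comment> \<open>nothing yet; Spoiler to move\<close>
  | ExM 'a                              \<comment> \<open>Duplicator to move\<close>
  | ExN 'b                              \<comment> \<open>Duplicator to move\<close>
  | TcM nat nat "'a set"                \<comment> \<open>pebble pairs \<open>i\<close>, \<open>j\<close> and \<open>A\<close> chosen; Duplicator to move\<close>
  | TcM_sets "'a set" "'b set"          \<comment> \<open>\<open>A\<close> answered by \<open>B\<close>; Spoiler to move\<close>
  | TcM_elems "'a set" "'b set" 'b 'b   \<comment> \<open>\<open>b'\<close>, \<open>b''\<close> chosen; Duplicator to move\<close>
  | TcN nat nat "'b set"                \<comment> \<open>pebble pairs \<open>i\<close>, \<open>j\<close> and \<open>B\<close> chosen; Duplicator to move\<close>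
  | TcN_sets "'a set" "'b set"          \<comment> \<open>\<open>B\<close> answered by \<open>A\<close>; Spoiler to move\<close>
  | TcN_elems "'a set" "'b set" 'a 'a   \<comment> \<open>\<open>a'\<close>, \<open>a''\<close> chosen; Duplicator to move\<close>

text \<open>A position consists of the number of rounds not yet completed, the board, and the phase of
  the current round.\<close>

type_synonym ('a, 'b) position = "nat \<times> ('a \<times> 'b) list \<times> ('a, 'b) phase"

inductive legal :: "('r, 'a) frame \<Rightarrow> ('r, 'b) frame \<Rightarrow>
    ('a, 'b) position \<Rightarrow> ('a, 'b) position \<Rightarrow> bool" for M N where
  ExM: "a \<in> univ M \<Longrightarrow> legal M N (Suc k, ps, Begin) (Suc k, ps, ExM a)"
| ExM_answer: "b \<in> univ N \<Longrightarrow> legal M N (Suc k, ps, ExM a) (k, ps @ [(a, b)], Begin)"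
| ExN: "b \<in> univ N \<Longrightarrow> legal M N (Suc k, ps, Begin) (Suc k, ps, ExN b)"
| ExN_answer: "a \<in> univ M \<Longrightarrow> legal M N (Suc k, ps, ExN b) (k, ps @ [(a, b)], Begin)"
| TcM: "i < length ps \<Longrightarrow> j < length ps \<Longrightarrow>
    A \<in> adm M \<Longrightarrow> fst (ps ! i) \<in> A \<Longrightarrow> fst (ps ! j) \<notin> A \<Longrightarrow>
    legal M N (Suc k, ps, Begin) (Suc k, ps, TcM i j A)"
| TcM_sets: "B \<in> adm N \<Longrightarrow> snd (ps ! i) \<in> B \<Longrightarrow> snd (ps ! j) \<notin> B \<Longrightarrow>
    legal M N (Suc k, ps, TcM i j A) (Suc k, ps, TcM_sets A B)"
| TcM_elems: "b' \<in> B \<Longrightarrow> b'' \<in> univ N - B \<Longrightarrow>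
    legal M N (Suc k, ps, TcM_sets A B) (Suc k, ps, TcM_elems A B b' b'')"
| TcM_answer: "a' \<in> A \<Longrightarrow> a'' \<in> univ M - A \<Longrightarrow>
    legal M N (Suc k, ps, TcM_elems A B b' b'') (k, ps @ [(a', b'), (a'', b'')], Begin)"
| TcN: "i < length ps \<Longrightarrow> j < length ps \<Longrightarrow>
    B \<in> adm N \<Longrightarrow> snd (ps ! i) \<in> B \<Longrightarrow> snd (ps ! j) \<notin> B \<Longrightarrow>
    legal M N (Suc k, ps, Begin) (Suc k, ps, TcN i j B)"
| TcN_sets: "A \<in> adm M \<Longrightarrow> fst (ps ! i) \<in> A \<Longrightarrow> fst (ps ! j) \<notin> A \<Longrightarrow>
    legal M N (Suc k, ps, TcN i j B) (Suc k, ps, TcN_sets A B)"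
| TcN_elems: "a' \<in> A \<Longrightarrow> a'' \<in> univ M - A \<Longrightarrow>
    legal M N (Suc k, ps, TcN_sets A B) (Suc k, ps, TcN_elems A B a' a'')"
| TcN_answer: "b' \<in> B \<Longrightarrow> b'' \<in> univ N - B \<Longrightarrow>
    legal M N (Suc k, ps, TcN_elems A B a' a'') (k, ps @ [(a', b'), (a'', b'')], Begin)"

fun over :: "('a, 'b) position \<Rightarrow> bool" where
  "over (k, ps, ph) \<longleftrightarrow> k = 0"

fun spoiler_turn :: "('a, 'b) position \<Rightarrow> bool" where
  "spoiler_turn (k, ps, Begin) \<longleftrightarrow> k > 0"
| "spoiler_turn (k, ps, TcM_sets A B) \<longleftrightarrow> k > 0"
| "spoiler_turn (k, ps, TcN_sets A B) \<longleftrightarrow> k > 0"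
| "spoiler_turn _ \<longleftrightarrow> False"

text \<open>A strategy of Spoiler maps the history of a play, i.e. the list of positions reached so far,
  to the next position. Plays in which Spoiler follows the strategy:\<close>

type_synonym ('a, 'b) strategy = "('a, 'b) position list \<Rightarrow> ('a, 'b) position"

inductive follows :: "('r, 'a) frame \<Rightarrow> ('r, 'b) frame \<Rightarrow> ('a, 'b) position \<Rightarrow>
    ('a, 'b) strategy \<Rightarrow> ('a, 'b) position list \<Rightarrow> bool" for M N p \<sigma> where
  start: "follows M N p \<sigma> [p]"
| spoiler: "follows M N p \<sigma> h \<Longrightarrow> spoiler_turn (last h) \<Longrightarrow> legal M N (last h) (\<sigma> h) \<Longrightarrow>
    follows M N p \<sigma> (h @ [\<sigma> h])"
| duplicator: "follows M N p \<sigma> h \<Longrightarrow> \<not> spoiler_turn (last h) \<Longrightarrow> legal M N (last h) q \<Longrightarrow>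
    follows M N p \<sigma> (h @ [q])"

text \<open>Spoiler must always be able to make the move prescribed by the strategy, and must win every
  play that reaches the end of the last round. Nothing is required of plays in which Duplicator
  gets stuck, which happens only if there is no suitable set to answer a TC-move: Duplicator then
  does not complete the rounds, so Spoiler wins.\<close>

definition winning_strategy :: "'r vocab \<Rightarrow> ('r, 'a) frame \<Rightarrow> ('r, 'b) frame \<Rightarrow>
    ('a, 'b) position \<Rightarrow> ('a, 'b) strategy \<Rightarrow> bool" where
  "winning_strategy V M N p \<sigma> \<longleftrightarrow>
     (\<forall>h. follows M N p \<sigma> h \<longrightarrow>
        (spoiler_turn (last h) \<longrightarrow> legal M N (last h) (\<sigma> h)) \<and>
        (over (last h) \<longrightarrow> \<not> partial_iso V M N (fst (snd (last h)))))"

definition spoiler_wins_EF :: "'r vocab \<Rightarrow> nat \<Rightarrow> ('r, 'a) frame \<Rightarrow> 'a list \<Rightarrow>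
    ('r, 'b) frame \<Rightarrow> 'b list \<Rightarrow> bool" where
  "spoiler_wins_EF V n M as N bs \<longleftrightarrow>
     (\<exists>\<sigma>. winning_strategy V M N (n, zip as bs, Begin) \<sigma>)"

end

theory Submission
  imports Defs
begin

text \<open>The game is determined, so that Spoiler has a winning strategy iff the initial position lies in
  the least set of positions closed under the backward moves. A distinguishing formula tells
  Spoiler how to play: a quantifier is an existential move, and a failing transitive closure
  provides the set for a TC-move. Conversely, over a finite vocabulary finitely many formulas
  suffice to distinguish all boards of a given size that Spoiler wins in \<open>k\<close> rounds. Hence the
  \<open>k\<close>-round type of a board is expressed by a single formula. A winning set \<open>A\<close> of Spoiler then
  yields the distinguishing formula \<open>[TC\<^sub>x\<^sub>y \<psi>](u,v)\<close>, where \<open>\<psi>\<close> says that \<open>(x,y)\<close> realises none of the types of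
  the pairs in \<open>A \<times> (univ M - A)\<close>.\<close>

section \<open>Determinacy\<close>

text \<open>Backward induction as a least fixed point. A stuck Duplicator loses because the last
  premise of the third rule then holds vacuously; the guard \<open>\<not> over p\<close> keeps
  finished positions, which admit no move either, from being won in this way.\<close>

inductive spoiler_wins :: "'r vocab \<Rightarrow> ('r, 'a) frame \<Rightarrow> ('r, 'b) frame \<Rightarrow>
    ('a, 'b) position \<Rightarrow> bool" for V M N where
  over: "over p \<Longrightarrow> \<not> partial_iso V M N (fst (snd p)) \<Longrightarrow> spoiler_wins V M N p"
| spoiler: "spoiler_turn p \<Longrightarrow> legal M N p q \<Longrightarrow> spoiler_wins V M N q \<Longrightarrow> spoiler_wins V M N p"
| duplicator: "\<not> over p \<Longrightarrow> \<not> spoiler_turn p \<Longrightarrow>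
    (\<And>q. legal M N p q \<Longrightarrow> spoiler_wins V M N q) \<Longrightarrow> spoiler_wins V M N p"

lemma spoiler_turn_not_over: "spoiler_turn p \<Longrightarrow> \<not> over p"
  by (cases p rule: spoiler_turn.cases) auto

text \<open>Counts the moves already made in the current round. A round has at most four, the last
  of which completes it; hence the factor 4 in \<open>rank\<close>.\<close>

fun stage :: "('a, 'b) phase \<Rightarrow> nat" where
  "stage Begin = 0"
| "stage (ExM a) = 1"
| "stage (ExN b) = 1"
| "stage (TcM i j A) = 1"
| "stage (TcM_sets A B) = 2"
| "stage (TcM_elems A B b' b'') = 3"
| "stage (TcN i j B) = 1"
| "stage (TcN_sets A B) = 2"
| "stage (TcN_elems A B a' a'') = 3"

fun rank :: "('a, 'b) position \<Rightarrow> nat" where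
  "rank (k, ps, ph) = 4 * k - stage ph"

lemma rank_legal: "legal M N p q \<Longrightarrow> rank q < rank p"
  by (induction rule: legal.induct) auto

text \<open>Every move lowers \<open>rank\<close>, so the plays following \<open>\<sigma>\<close>
  form a well-founded tree. Winning is carried back from its ends: along the prescribed move at
  Spoiler's turns, along all replies at Duplicator's.\<close>

lemma winning_strategy_imp_spoiler_wins:
  assumes "winning_strategy V M N p \<sigma>" "follows M N p \<sigma> h"
  shows "spoiler_wins V M N (last h)"
  using assms(2)
proof (induction "rank (last h)" arbitrary: h rule: less_induct)
  case less
  have win: "spoiler_turn (last h) \<Longrightarrow> legal M N (last h) (\<sigma> h)"
    "over (last h) \<Longrightarrow> \<not> partial_iso V M N (fst (snd (last h)))"
    using assms(1) less.prems by (auto simp: winning_strategy_def)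
  have step: "spoiler_wins V M N q" if "legal M N (last h) q" "follows M N p \<sigma> (h @ [q])" for q
    using less.hyps[of "h @ [q]"] that rank_legal by fastforce
  show ?case
  proof (cases "spoiler_turn (last h)")
    case True
    show ?thesis
      using spoiler_wins.spoiler[OF True win(1)[OF True]] step win(1)[OF True]
        follows.spoiler[OF less.prems True win(1)[OF True]] by blast
  next
    case False
    then show ?thesis
      using win(2) step follows.duplicator[OF less.prems False]
      by (cases "over (last h)") (blast intro: spoiler_wins.over spoiler_wins.duplicator)+
  qed
qed

lemma spoiler_wins_imp_winning_strategy:
  assumes "spoiler_wins V M N p"
  shows "\<exists>\<sigma>. winning_strategy V M N p \<sigma>"
proof -
  \<comment> \<open>The choice looks only at the last position of the history: any legal move that
    stays among the won positions.\<close>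
  define \<sigma> where "\<sigma> h = (SOME q. legal M N (last h) q \<and> spoiler_wins V M N q)" for h
  have \<sigma>: "legal M N (last h) (\<sigma> h) \<and> spoiler_wins V M N (\<sigma> h)"
    if "spoiler_wins V M N (last h)" "spoiler_turn (last h)" for h
  proof -
    from that(1) have "\<exists>q. legal M N (last h) q \<and> spoiler_wins V M N q"
      by cases (use that(2) spoiler_turn_not_over in blast)+
    then show ?thesis unfolding \<sigma>_def by (rule someI_ex)
  qed
  have inv: "spoiler_wins V M N (last h)" if "follows M N p \<sigma> h" for h
    using that
  proof induction
    case (duplicator h q)
    from duplicator.IH show ?case
    proof cases
      \<comment> \<open>No move leaves a finished position, so this case cannot arise.\<close>
      case over
      then show ?thesis using duplicator.hyps by (cases "last h") (auto elim: legal.cases)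
    qed (use duplicator.hyps in auto)
  qed (use assms \<sigma> in auto)
  have "\<not> partial_iso V M N (fst (snd q))" if "spoiler_wins V M N q" "over q" for q
    using that(1) by cases (use that(2) spoiler_turn_not_over in blast)+
  then show ?thesis
    unfolding winning_strategy_def using inv \<sigma> by blast
qed

lemma spoiler_wins_EF_iff:
  "spoiler_wins_EF V n M as N bs \<longleftrightarrow> spoiler_wins V M N (n, zip as bs, Begin)"
  unfolding spoiler_wins_EF_def
  using winning_strategy_imp_spoiler_wins[OF _ follows.start] spoiler_wins_imp_winning_strategy
  by fastforce

section \<open>One round of the game as a quantifier alternation\<close>

lemma spoiler_wins_0_iff: "spoiler_wins V M N (0, ps, Begin) \<longleftrightarrow> \<not> partial_iso V M N ps"
  by (subst spoiler_wins.simps) auto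

text \<open>Unrolls the fixed point through the phases of a round, with one disjunct for each kind
  of move. After this only positions at the beginning of a round have to be considered.\<close>

lemma spoiler_wins_Suc_iff:
  "spoiler_wins V M N (Suc k, ps, Begin) \<longleftrightarrow>
    (\<exists>a\<in>univ M. \<forall>b\<in>univ N. spoiler_wins V M N (k, ps @ [(a, b)], Begin)) \<or>
    (\<exists>b\<in>univ N. \<forall>a\<in>univ M. spoiler_wins V M N (k, ps @ [(a, b)], Begin)) \<or>
    (\<exists>i<length ps. \<exists>j<length ps. \<exists>A\<in>adm M. fst (ps ! i) \<in> A \<and> fst (ps ! j) \<notin> A \<and>
      (\<forall>B\<in>adm N. snd (ps ! i) \<in> B \<longrightarrow> snd (ps ! j) \<notin> B \<longrightarrow>
        (\<exists>b'\<in>B. \<exists>b''\<in>univ N - B. \<forall>a'\<in>A. \<forall>a''\<in>univ M - A.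
          spoiler_wins V M N (k, ps @ [(a', b'), (a'', b'')], Begin)))) \<or>
    (\<exists>i<length ps. \<exists>j<length ps. \<exists>B\<in>adm N. snd (ps ! i) \<in> B \<and> snd (ps ! j) \<notin> B \<and>
      (\<forall>A\<in>adm M. fst (ps ! i) \<in> A \<longrightarrow> fst (ps ! j) \<notin> A \<longrightarrow>
        (\<exists>a'\<in>A. \<exists>a''\<in>univ M - A. \<forall>b'\<in>B. \<forall>b''\<in>univ N - B.
          spoiler_wins V M N (k, ps @ [(a', b'), (a'', b'')], Begin))))"
proof -
  let ?W = "spoiler_wins V M N"
  have ExM: "?W (Suc k, ps, ExM a) \<longleftrightarrow> (\<forall>b\<in>univ N. ?W (k, ps @ [(a, b)], Begin))" for a
    by (subst spoiler_wins.simps) (auto simp: legal.simps)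
  have ExN: "?W (Suc k, ps, ExN b) \<longleftrightarrow> (\<forall>a\<in>univ M. ?W (k, ps @ [(a, b)], Begin))" for b
    by (subst spoiler_wins.simps) (auto simp: legal.simps)
  have TcM_elems: "?W (Suc k, ps, TcM_elems A B b' b'') \<longleftrightarrow>
    (\<forall>a'\<in>A. \<forall>a''\<in>univ M - A. ?W (k, ps @ [(a', b'), (a'', b'')], Begin))" for A B b' b''
    by (subst spoiler_wins.simps) (auto simp: legal.simps)
  have TcN_elems: "?W (Suc k, ps, TcN_elems A B a' a'') \<longleftrightarrow>
    (\<forall>b'\<in>B. \<forall>b''\<in>univ N - B. ?W (k, ps @ [(a', b'), (a'', b'')], Begin))" for A B a' a''
    by (subst spoiler_wins.simps) (auto simp: legal.simps)
  have TcM_sets: "?W (Suc k, ps, TcM_sets A B) \<longleftrightarrow>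
    (\<exists>b'\<in>B. \<exists>b''\<in>univ N - B. ?W (Suc k, ps, TcM_elems A B b' b''))" for A B
    by (subst spoiler_wins.simps) (auto simp: legal.simps)
  have TcN_sets: "?W (Suc k, ps, TcN_sets A B) \<longleftrightarrow>
    (\<exists>a'\<in>A. \<exists>a''\<in>univ M - A. ?W (Suc k, ps, TcN_elems A B a' a''))" for A B
    by (subst spoiler_wins.simps) (auto simp: legal.simps)
  have TcM: "?W (Suc k, ps, TcM i j A) \<longleftrightarrow>
    (\<forall>B\<in>adm N. snd (ps ! i) \<in> B \<longrightarrow> snd (ps ! j) \<notin> B \<longrightarrow> ?W (Suc k, ps, TcM_sets A B))" for i j A
    by (subst spoiler_wins.simps) (auto simp: legal.simps)
  have TcN: "?W (Suc k, ps, TcN i j B) \<longleftrightarrow>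
    (\<forall>A\<in>adm M. fst (ps ! i) \<in> A \<longrightarrow> fst (ps ! j) \<notin> A \<longrightarrow> ?W (Suc k, ps, TcN_sets A B))" for i j B
    by (subst spoiler_wins.simps) (auto simp: legal.simps)
  have Begin: "?W (Suc k, ps, Begin) \<longleftrightarrow>
    (\<exists>a\<in>univ M. ?W (Suc k, ps, ExM a)) \<or> (\<exists>b\<in>univ N. ?W (Suc k, ps, ExN b)) \<or>
    (\<exists>i<length ps. \<exists>j<length ps. \<exists>A\<in>adm M. fst (ps ! i) \<in> A \<and> fst (ps ! j) \<notin> A \<and>
      ?W (Suc k, ps, TcM i j A)) \<or>
    (\<exists>i<length ps. \<exists>j<length ps. \<exists>B\<in>adm N. snd (ps ! i) \<in> B \<and> snd (ps ! j) \<notin> B \<and>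
      ?W (Suc k, ps, TcN i j B))" (is "?L \<longleftrightarrow> ?R")
  proof
    assume ?L
    then obtain q where q: "legal M N (Suc k, ps, Begin) q" "?W q"
      by (auto elim: spoiler_wins.cases)
    from q(1) show ?R
    proof cases
      case (TcN i j B)
      then show ?thesis
        using q(2) by (intro disjI2 exI[of _ i] exI[of _ j] conjI bexI[of _ B]) auto
    qed (use q(2) in auto)
  next
    have *: "?W q \<Longrightarrow> legal M N (Suc k, ps, Begin) q \<Longrightarrow> ?L" for q
      by (rule spoiler_wins.spoiler) auto
    assume ?R
    then show ?L
      by (elim disjE bexE exE conjE) (erule *, auto intro: legal.intros)+
  qed
  show ?thesis
    unfolding Begin ExM ExN TcM TcN TcM_sets TcN_sets TcM_elems TcN_elems ..
qed

text \<open>This and the next three lemmas turn the four disjuncts of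
  \<open>spoiler_wins_Suc_iff\<close> into introduction rules.\<close>

lemma spoiler_wins_ExM:
  assumes "a \<in> univ M" "\<And>b. b \<in> univ N \<Longrightarrow> spoiler_wins V M N (k, ps @ [(a, b)], Begin)"
  shows "spoiler_wins V M N (Suc k, ps, Begin)"
  unfolding spoiler_wins_Suc_iff by (rule disjI1) (use assms in blast)

lemma spoiler_wins_ExN:
  assumes "b \<in> univ N" "\<And>a. a \<in> univ M \<Longrightarrow> spoiler_wins V M N (k, ps @ [(a, b)], Begin)"
  shows "spoiler_wins V M N (Suc k, ps, Begin)"
  unfolding spoiler_wins_Suc_iff by (rule disjI2, rule disjI1) (use assms in blast)

lemma spoiler_wins_TcM:
  assumes "i < length ps" "j < length ps" "A \<in> adm M" "fst (ps ! i) \<in> A" "fst (ps ! j) \<notin> A"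
    and "\<And>B. B \<in> adm N \<Longrightarrow> snd (ps ! i) \<in> B \<Longrightarrow> snd (ps ! j) \<notin> B \<Longrightarrow>
      \<exists>b'\<in>B. \<exists>b''\<in>univ N - B. \<forall>a'\<in>A. \<forall>a''\<in>univ M - A.
        spoiler_wins V M N (k, ps @ [(a', b'), (a'', b'')], Begin)"
  shows "spoiler_wins V M N (Suc k, ps, Begin)"
  unfolding spoiler_wins_Suc_iff
  by (rule disjI2, rule disjI2, rule disjI1) (use assms in blast)

lemma spoiler_wins_TcN:
  assumes "i < length ps" "j < length ps" "B \<in> adm N" "snd (ps ! i) \<in> B" "snd (ps ! j) \<notin> B"
    and "\<And>A. A \<in> adm M \<Longrightarrow> fst (ps ! i) \<in> A \<Longrightarrow> fst (ps ! j) \<notin> A \<Longrightarrow>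
      \<exists>a'\<in>A. \<exists>a''\<in>univ M - A. \<forall>b'\<in>B. \<forall>b''\<in>univ N - B.
        spoiler_wins V M N (k, ps @ [(a', b'), (a'', b'')], Begin)"
  shows "spoiler_wins V M N (Suc k, ps, Begin)"
  unfolding spoiler_wins_Suc_iff
  by (rule disjI2, rule disjI2, rule disjI2) (use assms in blast)

section \<open>Formulas and tuples\<close>

lemma sat_cong: "(\<And>v. v \<in> fv \<phi> \<Longrightarrow> g v = h v) \<Longrightarrow> sat M g \<phi> \<longleftrightarrow> sat M h \<phi>"
proof (induction \<phi> arbitrary: g h)
  case (Rel R us)
  then have "map g us = map h us" by simp
  then show ?case by (simp del: map_eq_conv)
next
  case (Neg \<phi>)
  then show ?case by (metis fv.simps(3) sat.simps(3))
next
  case (Conj \<phi> \<psi>)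
  then show ?case by (metis UnCI fv.simps(4) sat.simps(4))
next
  case (Ex x \<phi>)
  have "sat M (g(x := a)) \<phi> \<longleftrightarrow> sat M (h(x := a)) \<phi>" for a
    by (rule Ex.IH) (use Ex.prems in auto)
  then show ?case by simp
next
  case (TC x y \<phi> u v)
  have "sat M (g(x := a, y := b)) \<phi> \<longleftrightarrow> sat M (h(x := a, y := b)) \<phi>" for a b
    by (rule TC.IH) (use TC.prems in auto)
  moreover have "g u = h u" "g v = h v" using TC.prems by auto
  ultimately show ?case by simp
qed auto

text \<open>Admissible sets lie inside the universe, so a set is not closed under
  \<open>\<phi>\<close> iff some \<open>\<phi>\<close>-edge leaves it. In this form the operator has
  the shape of a TC-move: a set separating \<open>u\<close> from \<open>v\<close>, then a point
  inside it and a point outside.\<close>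

lemma sat_TC_iff:
  assumes "is_frame V M"
  shows "sat M g (TC x y \<phi> u v) \<longleftrightarrow>
    (\<forall>A\<in>adm M. g u \<in> A \<longrightarrow> g v \<notin> A \<longrightarrow>
      (\<exists>a\<in>A. \<exists>b\<in>univ M - A. sat M (g(x := a, y := b)) \<phi>))"
proof -
  have "(\<forall>a\<in>univ M. \<forall>b\<in>univ M. a \<in> A \<and> P a b \<longrightarrow> b \<in> A) \<longleftrightarrow>
      \<not> (\<exists>a\<in>A. \<exists>b\<in>univ M - A. P a b)" if "A \<in> adm M" for A P
    using assms that unfolding is_frame_def by blast
  then show ?thesis by (auto simp del: fun_upd_apply)
qed

text \<open>One fixed assignment instead of the quantified ones in \<open>true_of\<close>. Its
  values beyond the tuple may lie outside the universe, which does not affect formulas whose free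
  variables are below the length.\<close>

definition env :: "'a list \<Rightarrow> nat \<Rightarrow> 'a" where
  "env xs i = (if i < length xs then xs ! i else undefined)"

lemma env_append1: "env (xs @ [a]) = (env xs)(length xs := a)"
  by (auto simp: env_def nth_append fun_eq_iff)

lemma env_append2: "env (xs @ [a, b]) = (env xs)(length xs := a, Suc (length xs) := b)"
  using env_append1[of "xs @ [a]" b] by (simp add: env_append1)

lemma true_of_iff_sat_env:
  assumes "is_frame V M" "set xs \<subseteq> univ M" "fv \<phi> \<subseteq> {..<length xs}"
  shows "true_of M xs \<phi> \<longleftrightarrow> sat M (env xs) \<phi>"
proof -
  obtain d where d: "d \<in> univ M" using assms(1) by (auto simp: is_frame_def)
  define g where "g i = (if i < length xs then xs ! i else d)" for i
  have "range g \<subseteq> univ M" using d assms(2) by (auto simp: g_def)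
  moreover have "sat M h \<phi> \<longleftrightarrow> sat M (env xs) \<phi>" if "\<forall>i<length xs. h i = xs ! i" for h
    by (rule sat_cong) (use that assms(3) in \<open>auto simp: env_def\<close>)
  ultimately show ?thesis unfolding true_of_def by (metis g_def)
qed

lemma distinguishes_iff_sat_env:
  assumes "is_frame V M" "set as \<subseteq> univ M" "fv \<phi> \<subseteq> {..<length as}"
    and "is_frame V N" "set bs \<subseteq> univ N" "length bs = length as"
  shows "distinguishes \<phi> M as N bs \<longleftrightarrow> sat M (env as) \<phi> \<noteq> sat N (env bs) \<phi>"
  using true_of_iff_sat_env[OF assms(1-3)] true_of_iff_sat_env[OF assms(4,5), of \<phi>] assms(3,6)
  unfolding distinguishes_def by auto

text \<open>Truth need not have a quantifier-free sentence, so the empty conjunction \<open>Eq 0 0\<close> has the free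
  variable \<open>0\<close>.
  Conjunctions are therefore only formed over at least one variable, hence \<open>Suc m\<close> below.\<close>

definition big_conj :: "'r fm set \<Rightarrow> 'r fm" where
  "big_conj S = foldr Conj (SOME l. set l = S) (Eq 0 0)"

lemma big_conj:
  assumes "finite S"
  shows sat_big_conj: "sat M g (big_conj S) \<longleftrightarrow> (\<forall>\<phi>\<in>S. sat M g \<phi>)"
    and wf_big_conj: "wf_fm V (big_conj S) \<longleftrightarrow> (\<forall>\<phi>\<in>S. wf_fm V \<phi>)"
    and fv_big_conj: "fv (big_conj S) = insert 0 (\<Union>\<phi>\<in>S. fv \<phi>)"
    and qdepth_big_conj: "qdepth (big_conj S) \<le> k \<longleftrightarrow> (\<forall>\<phi>\<in>S. qdepth \<phi> \<le> k)"
proof -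
  define l where "l = (SOME l. set l = S)"
  have l: "set l = S" unfolding l_def by (rule someI_ex) (rule finite_list[OF assms])
  have eq: "big_conj S = foldr Conj l (Eq 0 0)" by (simp add: big_conj_def l_def)
  have "sat M g (foldr Conj l (Eq 0 0)) \<longleftrightarrow> (\<forall>\<phi>\<in>set l. sat M g \<phi>)" by (induction l) auto
  then show "sat M g (big_conj S) \<longleftrightarrow> (\<forall>\<phi>\<in>S. sat M g \<phi>)" by (simp add: eq l)
  have "wf_fm V (foldr Conj l (Eq 0 0)) \<longleftrightarrow> (\<forall>\<phi>\<in>set l. wf_fm V \<phi>)" by (induction l) auto
  then show "wf_fm V (big_conj S) \<longleftrightarrow> (\<forall>\<phi>\<in>S. wf_fm V \<phi>)" by (simp add: eq l)
  have "fv (foldr Conj l (Eq 0 0)) = insert 0 (\<Union>\<phi>\<in>set l. fv \<phi>)" by (induction l) auto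
  then show "fv (big_conj S) = insert 0 (\<Union>\<phi>\<in>S. fv \<phi>)" by (simp add: eq l)
  have "qdepth (foldr Conj l (Eq 0 0)) \<le> k \<longleftrightarrow> (\<forall>\<phi>\<in>set l. qdepth \<phi> \<le> k)" by (induction l) auto
  then show "qdepth (big_conj S) \<le> k \<longleftrightarrow> (\<forall>\<phi>\<in>S. qdepth \<phi> \<le> k)" by (simp add: eq l)
qed

section \<open>Types over a finite set of formulas\<close>

definition type_fm :: "'r fm set \<Rightarrow> 'r fm set \<Rightarrow> 'r fm" where
  "type_fm S T = big_conj (T \<union> Neg ` (S - T))"

definition type_in :: "'r fm set \<Rightarrow> ('r, 'a) frame \<Rightarrow> 'a list \<Rightarrow> 'r fm set" where
  "type_in S M xs = {\<phi> \<in> S. sat M (env xs) \<phi>}"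

lemma type_in_subset: "type_in S M xs \<subseteq> S"
  by (auto simp: type_in_def)

lemma type_in_eq_iff:
  "type_in S M xs = type_in S N ys \<longleftrightarrow> (\<forall>\<phi>\<in>S. sat M (env xs) \<phi> \<longleftrightarrow> sat N (env ys) \<phi>)"
  by (auto simp: type_in_def)

text \<open>Serves as the edge relation under the transitive closure operator: the pairs with a type
  in \<open>\<Theta>\<close> are the non-edges.\<close>

definition no_type :: "'r fm set \<Rightarrow> 'r fm set set \<Rightarrow> 'r fm" where
  "no_type S \<Theta> = big_conj ((\<lambda>T. Neg (type_fm S T)) ` \<Theta>)"

lemma sat_type_fm:
  assumes "finite S" "T \<subseteq> S"
  shows "sat M (env xs) (type_fm S T) \<longleftrightarrow> type_in S M xs = T"
proof -
  have "finite (T \<union> Neg ` (S - T))" using assms finite_subset by auto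
  then have "sat M (env xs) (type_fm S T) \<longleftrightarrow>
      (\<forall>\<phi>\<in>T. sat M (env xs) \<phi>) \<and> (\<forall>\<phi>\<in>S - T. \<not> sat M (env xs) \<phi>)"
    by (simp add: type_fm_def sat_big_conj ball_Un)
  then show ?thesis using assms(2) by (auto simp: type_in_def)
qed

lemma sat_no_type:
  assumes "finite S" "\<Theta> \<subseteq> Pow S"
  shows "sat M (env xs) (no_type S \<Theta>) \<longleftrightarrow> type_in S M xs \<notin> \<Theta>"
proof -
  \<comment> \<open>A finite \<open>S\<close> has finitely many types, so the conjunction is finite
    even if \<open>\<Theta>\<close> collects the types of infinitely many pairs.\<close>
  have "finite ((\<lambda>T. Neg (type_fm S T)) ` \<Theta>)"
    using assms finite_subset by (meson finite_Pow_iff finite_imageI)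
  then show ?thesis
    unfolding no_type_def using assms
    by (auto simp: sat_big_conj sat_type_fm[OF assms(1)] subset_iff)
qed

text \<open>Depth at most \<open>k\<close> lets formulas of different depths be combined; the exact
  depth is restored at the end by padding.\<close>

definition bounded_fms :: "'r vocab \<Rightarrow> nat \<Rightarrow> nat \<Rightarrow> 'r fm set" where
  "bounded_fms V k m = {\<phi>. wf_fm V \<phi> \<and> fv \<phi> \<subseteq> {..<m} \<and> qdepth \<phi> \<le> k}"

text \<open>In the construction below the conjunctions always stand under a quantifier or a TC
  operator, whose bound variables guarantee that at least one variable is available.\<close>

lemma big_conj_bounded:
  assumes "finite S" "S \<subseteq> bounded_fms V k (Suc m)"
  shows "big_conj S \<in> bounded_fms V k (Suc m)"
  using assms(2) unfolding bounded_fms_def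
  by (auto simp: wf_big_conj fv_big_conj qdepth_big_conj assms(1))

lemma type_fm_bounded:
  assumes "finite S" "S \<subseteq> bounded_fms V k (Suc m)" "T \<subseteq> S"
  shows "type_fm S T \<in> bounded_fms V k (Suc m)"
proof -
  have "finite (T \<union> Neg ` (S - T))" using assms finite_subset by auto
  moreover have "T \<union> Neg ` (S - T) \<subseteq> bounded_fms V k (Suc m)"
    using assms(2,3) by (force simp: bounded_fms_def)
  ultimately show ?thesis unfolding type_fm_def by (rule big_conj_bounded)
qed

lemma no_type_bounded:
  assumes "finite S" "S \<subseteq> bounded_fms V k (Suc m)" "\<Theta> \<subseteq> Pow S"
  shows "no_type S \<Theta> \<in> bounded_fms V k (Suc m)"
proof -
  have "finite ((\<lambda>T. Neg (type_fm S T)) ` \<Theta>)"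
    using assms finite_subset by (meson finite_Pow_iff finite_imageI)
  moreover have "Neg (type_fm S T) \<in> bounded_fms V k (Suc m)" if "T \<in> \<Theta>" for T
    using type_fm_bounded[OF assms(1,2), of T] assms(3) that by (auto simp: bounded_fms_def)
  ultimately show ?thesis unfolding no_type_def by (intro big_conj_bounded) auto
qed

text \<open>Variable \<open>m\<close> names the entry appended to a tuple of length
  \<open>m\<close>, so binding it removes just the newest pebble. In \<open>TC_bounded\<close>,
  \<open>m\<close> and \<open>Suc m\<close> name the two newest ones.\<close>

lemma Ex_bounded:
  "\<phi> \<in> bounded_fms V k (Suc m) \<Longrightarrow> Ex m \<phi> \<in> bounded_fms V (Suc k) m"
  by (auto simp: bounded_fms_def lessThan_Suc)

lemma TC_bounded:
  "\<phi> \<in> bounded_fms V k (Suc (Suc m)) \<Longrightarrow> i < m \<Longrightarrow> j < m \<Longrightarrow>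
    TC m (Suc m) \<phi> i j \<in> bounded_fms V (Suc k) m"
  by (auto simp: bounded_fms_def lessThan_Suc)

text \<open>Finiteness of the vocabulary enters here: there are finitely many symbols, each of fixed
  arity, and finitely many variables to fill their places.\<close>

lemma finite_atomic_fms:
  assumes "finite (syms V)"
  shows "finite {\<phi>. wf_fm V \<phi> \<and> atomic \<phi> \<and> fv \<phi> \<subseteq> {..<m}}" (is "finite ?F")
proof -
  have "?F \<subseteq> case_prod Eq ` ({..<m} \<times> {..<m}) \<union>
      (\<Union>R\<in>syms V. Rel R ` {us. set us \<subseteq> {..<m} \<and> length us = arity V R})" (is "_ \<subseteq> ?G")
  proof
    fix \<phi> assume "\<phi> \<in> ?F"
    then show "\<phi> \<in> ?G" by (cases \<phi>) force+
  qed
  moreover have "finite ?G" using assms by (simp add: finite_lists_length_eq)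
  ultimately show ?thesis by (rule finite_subset)
qed

text \<open>Since \<open>m\<close> is not free in \<open>\<phi>\<close>, the added quantifiers are
  vacuous; they serve only to raise the depth.\<close>

lemma pad_bounded:
  assumes "\<phi> \<in> bounded_fms V k m"
  shows "(Ex m ^^ l) \<phi> \<in> bounded_fms V (l + k) m" "qdepth ((Ex m ^^ l) \<phi>) = l + qdepth \<phi>"
  using assms by (induction l) (auto simp: bounded_fms_def)

lemma sat_pad:
  assumes "univ M \<noteq> {}" "\<phi> \<in> bounded_fms V k m"
  shows "sat M g ((Ex m ^^ l) \<phi>) \<longleftrightarrow> sat M g \<phi>"
proof (induction l arbitrary: g)
  case (Suc l)
  have "sat M (g(m := a)) \<phi> \<longleftrightarrow> sat M g \<phi>" for a
    by (rule sat_cong) (use assms(2) in \<open>auto simp: bounded_fms_def\<close>)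
  then show ?case using Suc assms(1) by (auto simp del: fun_upd_apply)
qed simp

section \<open>From formulas to strategies\<close>

text \<open>A violated atom stays violated when pebbles are added, so Spoiler can spend the
  remaining rounds on arbitrary existential moves; a nonempty universe makes these possible.\<close>

lemma atomic_distinguishes_imp_spoiler_wins:
  assumes "is_frame V M" "is_frame V N" "set ps \<subseteq> univ M \<times> univ N"
    and "wf_fm V \<phi>" "atomic \<phi>" "fv \<phi> \<subseteq> {..<length ps}"
    and "sat M (env (map fst ps)) \<phi> \<noteq> sat N (env (map snd ps)) \<phi>"
  shows "spoiler_wins V M N (k, ps, Begin)"
  using assms(3,6,7)
proof (induction k arbitrary: ps)
  case 0
  have "set (map fst ps) \<subseteq> univ M" "set (map snd ps) \<subseteq> univ N" using 0(1) by auto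
  then have "true_of M (map fst ps) \<phi> \<noteq> true_of N (map snd ps) \<phi>"
    using true_of_iff_sat_env[OF assms(1), of "map fst ps" \<phi>]
      true_of_iff_sat_env[OF assms(2), of "map snd ps" \<phi>] 0 by auto
  then show ?case
    using assms(4,5) 0(2) by (auto simp: spoiler_wins_0_iff partial_iso_def)
next
  case (Suc k)
  obtain a where a: "a \<in> univ M" using assms(1) by (auto simp: is_frame_def)
  have "spoiler_wins V M N (k, ps @ [(a, b)], Begin)" if "b \<in> univ N" for b
  proof (rule Suc.IH)
    have "sat M (env (map fst (ps @ [(a, b)]))) \<phi> \<longleftrightarrow> sat M (env (map fst ps)) \<phi>"
      by (rule sat_cong) (use Suc.prems(2) in \<open>auto simp: env_append1\<close>)
    moreover have "sat N (env (map snd (ps @ [(a, b)]))) \<phi> \<longleftrightarrow> sat N (env (map snd ps)) \<phi>"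
      by (rule sat_cong) (use Suc.prems(2) in \<open>auto simp: env_append1\<close>)
    ultimately show "sat M (env (map fst (ps @ [(a, b)]))) \<phi> \<noteq>
        sat N (env (map snd (ps @ [(a, b)]))) \<phi>"
      using Suc.prems(3) by blast
  qed (use Suc.prems a that in auto)
  then show ?case using a by (blast intro: spoiler_wins_ExM)
qed

text \<open>The assignments are tied to the board only through pairs of values, not through pebble
  positions. Variables may thus be bound again, and the board may hold pairs that no variable names
  any more.\<close>

lemma distinguishes_imp_spoiler_wins:
  assumes frames: "is_frame V M" "is_frame V N"
    and "set ps \<subseteq> univ M \<times> univ N" "wf_fm V \<phi>" "qdepth \<phi> \<le> k"
    and "\<And>v. v \<in> fv \<phi> \<Longrightarrow> (g v, h v) \<in> set ps"
    and "sat M g \<phi> \<noteq> sat N h \<phi>"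
  shows "spoiler_wins V M N (k, ps, Begin)"
  using assms(3-)
proof (induction \<phi> arbitrary: g h ps k)
  case (Eq u v)
  obtain i where i: "i < length ps" "ps ! i = (g u, h u)"
    using Eq.prems(4)[of u] by (auto simp: in_set_conv_nth)
  obtain j where j: "j < length ps" "ps ! j = (g v, h v)"
    using Eq.prems(4)[of v] by (auto simp: in_set_conv_nth)
  show ?case
    by (rule atomic_distinguishes_imp_spoiler_wins[OF frames, where \<phi> = "Eq i j"])
      (use Eq.prems i j in \<open>auto simp: env_def\<close>)
next
  case (Rel R us)
  have "\<forall>v\<in>set us. \<exists>i<length ps. ps ! i = (g v, h v)"
    using Rel.prems(4) by (auto simp: in_set_conv_nth)
  \<comment> \<open>\<open>e\<close> renames each variable to the position of a pebble pair carrying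
    its values, because partial isomorphism is tested on positions.\<close>
  then obtain e where e: "\<And>v. v \<in> set us \<Longrightarrow> e v < length ps \<and> ps ! e v = (g v, h v)"
    by metis
  have "map (env (map fst ps)) (map e us) = map g us" "map (env (map snd ps)) (map e us) = map h us"
    using e by (auto simp: env_def)
  then show ?case
    by (intro atomic_distinguishes_imp_spoiler_wins[OF frames, where \<phi> = "Rel R (map e us)"])
      (use Rel.prems e in \<open>auto simp del: map_map map_eq_conv\<close>)
next
  case (Neg \<phi>)
  then show ?case by auto
next
  case (Conj \<phi> \<psi>)
  show ?case
  proof (cases "sat M g \<phi> = sat N h \<phi>")
    case True
    show ?thesis by (rule Conj.IH(2)) (use True Conj.prems in auto)
  next
    case False
    show ?thesis by (rule Conj.IH(1)) (use False Conj.prems in auto)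
  qed
next
  case (Ex x \<phi>)
  then obtain l where k: "k = Suc l" by (cases k) auto
  have *: "spoiler_wins V M N (l, ps @ [(a, b)], Begin)"
    if "a \<in> univ M" "b \<in> univ N" "sat M (g(x := a)) \<phi> \<noteq> sat N (h(x := b)) \<phi>" for a b
    by (rule Ex.IH[OF _ _ _ _ that(3)]) (use Ex.prems(1-4) that(1,2) k in auto)
  \<comment> \<open>A witness on the side where the formula holds disagrees with every element of
    the other side.\<close>
  have "(\<exists>a\<in>univ M. \<forall>b\<in>univ N. sat M (g(x := a)) \<phi> \<noteq> sat N (h(x := b)) \<phi>) \<or>
      (\<exists>b\<in>univ N. \<forall>a\<in>univ M. sat M (g(x := a)) \<phi> \<noteq> sat N (h(x := b)) \<phi>)"
    using Ex.prems(5) by (simp only: sat.simps) blast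
  then show ?case
    unfolding k by (elim disjE bexE) (blast intro: spoiler_wins_ExM spoiler_wins_ExN *)+
next
  case (TC x y \<phi> u v)
  then obtain l where k: "k = Suc l" by (cases k) auto
  have *: "spoiler_wins V M N (l, ps @ [(a', b'), (a'', b'')], Begin)"
    if "a' \<in> univ M" "b' \<in> univ N" "a'' \<in> univ M" "b'' \<in> univ N"
      "sat M (g(x := a', y := a'')) \<phi> \<noteq> sat N (h(x := b', y := b'')) \<phi>" for a' a'' b' b''
    by (rule TC.IH[OF _ _ _ _ that(5)]) (use TC.prems(1-4) that(1-4) k in auto)
  obtain i where i: "i < length ps" "ps ! i = (g u, h u)"
    using TC.prems(4)[of u] by (auto simp: in_set_conv_nth)
  obtain j where j: "j < length ps" "ps ! j = (g v, h v)"
    using TC.prems(4)[of v] by (auto simp: in_set_conv_nth)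
  have adm: "\<And>A. A \<in> adm M \<Longrightarrow> A \<subseteq> univ M" "\<And>B. B \<in> adm N \<Longrightarrow> B \<subseteq> univ N"
    using frames by (auto simp: is_frame_def)
  show ?case
  proof (cases "sat M g (TC x y \<phi> u v)")
    case True
    then have "\<not> sat N h (TC x y \<phi> u v)" using TC.prems(5) by blast
    \<comment> \<open>Spoiler plays a closed set \<open>B\<close> that refutes the closure in
      \<open>N\<close>. Duplicator's \<open>A\<close> is left by a \<open>\<phi>\<close>-edge in
      \<open>M\<close>, which Spoiler picks; no answer across the boundary of \<open>B\<close> is an
      edge.\<close>
    then obtain B where B: "B \<in> adm N" "h u \<in> B" "h v \<notin> B"
      and cl: "\<And>a b. a \<in> B \<Longrightarrow> b \<in> univ N - B \<Longrightarrow> \<not> sat N (h(x := a, y := b)) \<phi>"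
      unfolding sat_TC_iff[OF frames(2)] by blast
    have "\<exists>a'\<in>A. \<exists>a''\<in>univ M - A. \<forall>b'\<in>B. \<forall>b''\<in>univ N - B.
        spoiler_wins V M N (l, ps @ [(a', b'), (a'', b'')], Begin)"
      if A: "A \<in> adm M" "g u \<in> A" "g v \<notin> A" for A
    proof -
      obtain a' a'' where a: "a' \<in> A" "a'' \<in> univ M - A" "sat M (g(x := a', y := a'')) \<phi>"
        using True A unfolding sat_TC_iff[OF frames(1)] by blast
      have "spoiler_wins V M N (l, ps @ [(a', b'), (a'', b'')], Begin)"
        if "b' \<in> B" "b'' \<in> univ N - B" for b' b''
        by (rule *) (use a cl[OF that] that adm(1)[OF A(1)] adm(2)[OF B(1)] in
          \<open>auto simp del: fun_upd_apply\<close>)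
      then show ?thesis using a by blast
    qed
    then show ?thesis
      unfolding k using i j B by (intro spoiler_wins_TcN[of i ps j B]) simp_all
  next
    case False
    then have True': "sat N h (TC x y \<phi> u v)" using TC.prems(5) by blast
    from False obtain A where A: "A \<in> adm M" "g u \<in> A" "g v \<notin> A"
      and cl: "\<And>a b. a \<in> A \<Longrightarrow> b \<in> univ M - A \<Longrightarrow> \<not> sat M (g(x := a, y := b)) \<phi>"
      unfolding sat_TC_iff[OF frames(1)] by blast
    have "\<exists>b'\<in>B. \<exists>b''\<in>univ N - B. \<forall>a'\<in>A. \<forall>a''\<in>univ M - A.
        spoiler_wins V M N (l, ps @ [(a', b'), (a'', b'')], Begin)"
      if B: "B \<in> adm N" "h u \<in> B" "h v \<notin> B" for B
    proof -
      obtain b' b'' where b: "b' \<in> B" "b'' \<in> univ N - B" "sat N (h(x := b', y := b'')) \<phi>"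
        using True' B unfolding sat_TC_iff[OF frames(2)] by blast
      have "spoiler_wins V M N (l, ps @ [(a', b'), (a'', b'')], Begin)"
        if "a' \<in> A" "a'' \<in> univ M - A" for a' a''
        by (rule *) (use b cl[OF that] that adm(1)[OF A(1)] adm(2)[OF B(1)] in
          \<open>auto simp del: fun_upd_apply\<close>)
      then show ?thesis using b by blast
    qed
    then show ?thesis
      unfolding k using i j A by (intro spoiler_wins_TcM[of i ps j A]) simp_all
  qed
qed

section \<open>From strategies to formulas\<close>

lemma sat_Ex_type:
  assumes "finite S" "T \<subseteq> S" "length xs = m"
  shows "sat M (env xs) (Ex m (type_fm S T)) \<longleftrightarrow> (\<exists>a\<in>univ M. type_in S M (xs @ [a]) = T)"
proof -
  have "sat M ((env xs)(m := a)) (type_fm S T) \<longleftrightarrow> type_in S M (xs @ [a]) = T" for a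
    using sat_type_fm[OF assms(1,2), of M "xs @ [a]"] by (simp add: env_append1 assms(3))
  then show ?thesis by simp
qed

lemma sat_TC_no_type:
  assumes "is_frame V M" "finite S" "\<Theta> \<subseteq> Pow S" "length xs = m" "i < m" "j < m"
  shows "sat M (env xs) (TC m (Suc m) (no_type S \<Theta>) i j) \<longleftrightarrow>
    (\<forall>A\<in>adm M. xs ! i \<in> A \<longrightarrow> xs ! j \<notin> A \<longrightarrow>
      (\<exists>a'\<in>A. \<exists>a''\<in>univ M - A. type_in S M (xs @ [a', a'']) \<notin> \<Theta>))"
proof -
  have "sat M ((env xs)(m := a, Suc m := b)) (no_type S \<Theta>) \<longleftrightarrow> type_in S M (xs @ [a, b]) \<notin> \<Theta>" for a b
    using sat_no_type[OF assms(2,3), of M "xs @ [a, b]"] by (simp add: env_append2 assms(4))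
  moreover have "env xs i = xs ! i" "env xs j = xs ! j" using assms(4-6) by (auto simp: env_def)
  ultimately show ?thesis by (simp only: sat_TC_iff[OF assms(1)])
qed

text \<open>One finite \<open>S\<close> has to serve all boards of length \<open>m\<close>:
  Spoiler's sets may be infinite, and the pairs crossing them must still fall into finitely many
  types. The length is arbitrary in the induction because a round adds one or two pairs.\<close>

lemma spoiler_wins_imp_distinguishes:
  fixes M :: "('r, 'a) frame" and N :: "('r, 'b) frame"
  assumes frames: "is_frame V M" "is_frame V N" and "finite (syms V)"
  shows "\<exists>S. finite S \<and> S \<subseteq> bounded_fms V k m \<and>
    (\<forall>ps. length ps = m \<and> set ps \<subseteq> univ M \<times> univ N \<and> spoiler_wins V M N (k, ps, Begin) \<longrightarrow>
      type_in S M (map fst ps) \<noteq> type_in S N (map snd ps))"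
proof (induction k arbitrary: m)
  case 0
  define S where "S = {\<phi>. wf_fm V \<phi> \<and> atomic \<phi> \<and> fv \<phi> \<subseteq> {..<m}}"
  have "qdepth \<phi> = 0" if "atomic \<phi>" for \<phi> :: "'r fm" using that by (cases \<phi>) auto
  then have "S \<subseteq> bounded_fms V 0 m" by (auto simp: S_def bounded_fms_def)
  moreover have "type_in S M (map fst ps) \<noteq> type_in S N (map snd ps)"
    if ps: "length ps = m" "set ps \<subseteq> univ M \<times> univ N" "\<not> partial_iso V M N ps" for ps
  proof -
    obtain \<phi> where "\<phi> \<in> S" "true_of M (map fst ps) \<phi> \<noteq> true_of N (map snd ps) \<phi>"
      using ps by (auto simp: partial_iso_def S_def)
    moreover have "set (map fst ps) \<subseteq> univ M" "set (map snd ps) \<subseteq> univ N" using ps(2) by auto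
    ultimately show ?thesis
      using true_of_iff_sat_env[OF frames(1), of "map fst ps" \<phi>]
        true_of_iff_sat_env[OF frames(2), of "map snd ps" \<phi>] ps(1)
      unfolding type_in_eq_iff by (auto simp: S_def)
  qed
  ultimately show ?case
    unfolding spoiler_wins_0_iff using finite_atomic_fms[OF assms(3), of m]
    by (intro exI[of _ S]) (simp add: S_def)
next
  case (Suc k)
  \<comment> \<open>\<open>S1\<close> handles the board after an existential move, \<open>S2\<close>
    the board after a TC-move.\<close>
  obtain S1 where S1: "finite S1" "S1 \<subseteq> bounded_fms V k (Suc m)"
    and dist1: "\<forall>ps. length ps = Suc m \<and> set ps \<subseteq> univ M \<times> univ N \<and>
      spoiler_wins V M N (k, ps, Begin) \<longrightarrow> type_in S1 M (map fst ps) \<noteq> type_in S1 N (map snd ps)"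
    using Suc[of "Suc m"] by (elim exE conjE) (rule that)
  obtain S2 where S2: "finite S2" "S2 \<subseteq> bounded_fms V k (Suc (Suc m))"
    and dist2: "\<forall>ps. length ps = Suc (Suc m) \<and> set ps \<subseteq> univ M \<times> univ N \<and>
      spoiler_wins V M N (k, ps, Begin) \<longrightarrow> type_in S2 M (map fst ps) \<noteq> type_in S2 N (map snd ps)"
    using Suc[of "Suc (Suc m)"] by (elim exE conjE) (rule that)
  \<comment> \<open>Each formula of \<open>E\<close> says that some new element realises a given
    type. \<open>C\<close> provides a closure formula for each set of forbidden types and each
    choice of two pebbles. Both families depend on \<open>m\<close> but not on the board.\<close>
  define E where "E = (\<lambda>T. Ex m (type_fm S1 T)) ` Pow S1"
  define C where "C = (\<lambda>(\<Theta>, i, j). TC m (Suc m) (no_type S2 \<Theta>) i j) `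
    (Pow (Pow S2) \<times> {..<m} \<times> {..<m})"
  have "E \<subseteq> bounded_fms V (Suc k) m"
    using Ex_bounded[OF type_fm_bounded[OF S1]] by (auto simp: E_def)
  moreover have "C \<subseteq> bounded_fms V (Suc k) m"
    using TC_bounded[OF no_type_bounded[OF S2]] by (auto simp: C_def)
  moreover have "finite (E \<union> C)" using S1(1) S2(1) by (simp add: E_def C_def)
  moreover have "type_in (E \<union> C) M (map fst ps) \<noteq> type_in (E \<union> C) N (map snd ps)"
    if ps: "length ps = m" "set ps \<subseteq> univ M \<times> univ N"
      "spoiler_wins V M N (Suc k, ps, Begin)" for ps
  proof -
    let ?xs = "map fst ps" and ?ys = "map snd ps"
    have adm: "\<And>A. A \<in> adm M \<Longrightarrow> A \<subseteq> univ M" "\<And>B. B \<in> adm N \<Longrightarrow> B \<subseteq> univ N"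
      using frames by (auto simp: is_frame_def)
    have d1: "type_in S1 M (?xs @ [a]) \<noteq> type_in S1 N (?ys @ [b])"
      if "a \<in> univ M" "b \<in> univ N" "spoiler_wins V M N (k, ps @ [(a, b)], Begin)" for a b
      using dist1[rule_format, of "ps @ [(a, b)]"] that ps(1,2) by auto
    have d2: "type_in S2 M (?xs @ [a', a'']) \<noteq> type_in S2 N (?ys @ [b', b''])"
      if "a' \<in> univ M" "b' \<in> univ N" "a'' \<in> univ M" "b'' \<in> univ N"
        "spoiler_wins V M N (k, ps @ [(a', b'), (a'', b'')], Begin)" for a' a'' b' b''
      using dist2[rule_format, of "ps @ [(a', b'), (a'', b'')]"] that ps(1,2) by auto
    have len: "length ?xs = m" "length ?ys = m" using ps(1) by auto
    have nth: "?xs ! i = fst (ps ! i)" "?ys ! i = snd (ps ! i)" if "i < m" for i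
      using that ps(1) by auto
    have EI: ?thesis
      if "T \<subseteq> S1" "(\<exists>a\<in>univ M. type_in S1 M (?xs @ [a]) = T) \<noteq>
        (\<exists>b\<in>univ N. type_in S1 N (?ys @ [b]) = T)" for T
    proof -
      have "Ex m (type_fm S1 T) \<in> E \<union> C" using that(1) by (auto simp: E_def)
      moreover have "sat M (env ?xs) (Ex m (type_fm S1 T)) \<noteq> sat N (env ?ys) (Ex m (type_fm S1 T))"
        using that(2) sat_Ex_type[OF S1(1) that(1), of ?xs m M]
          sat_Ex_type[OF S1(1) that(1), of ?ys m N] ps(1) by simp
      ultimately show ?thesis unfolding type_in_eq_iff by blast
    qed
    let ?PM = "\<lambda>\<Theta> i j. \<forall>A\<in>adm M. fst (ps ! i) \<in> A \<longrightarrow> fst (ps ! j) \<notin> A \<longrightarrow>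
      (\<exists>a'\<in>A. \<exists>a''\<in>univ M - A. type_in S2 M (?xs @ [a', a'']) \<notin> \<Theta>)"
    let ?PN = "\<lambda>\<Theta> i j. \<forall>B\<in>adm N. snd (ps ! i) \<in> B \<longrightarrow> snd (ps ! j) \<notin> B \<longrightarrow>
      (\<exists>b'\<in>B. \<exists>b''\<in>univ N - B. type_in S2 N (?ys @ [b', b'']) \<notin> \<Theta>)"
    have CI: ?thesis
      if "\<Theta> \<subseteq> Pow S2" "i < m" "j < m"
        "?PM \<Theta> i j \<noteq> ?PN \<Theta> i j" for \<Theta> i j
    proof -
      let ?\<phi> = "TC m (Suc m) (no_type S2 \<Theta>) i j"
      have "?\<phi> \<in> C"
        unfolding C_def by (rule image_eqI[of _ _ "(\<Theta>, i, j)"]) (use that(1-3) in auto)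
      moreover have "sat M (env ?xs) ?\<phi> \<noteq> sat N (env ?ys) ?\<phi>"
        unfolding sat_TC_no_type[OF frames(1) S2(1) that(1) len(1) that(2,3)]
          sat_TC_no_type[OF frames(2) S2(1) that(1) len(2) that(2,3)] nth[OF that(2)] nth[OF that(3)]
        by (rule that(4))
      ultimately show ?thesis unfolding type_in_eq_iff by blast
    qed
    have neq: "P \<noteq> Q" if "\<not> P" "Q" for P Q using that by blast
    from ps(3)[unfolded spoiler_wins_Suc_iff ps(1)] show ?thesis
    proof (elim disjE bexE exE conjE)
      fix a
      assume "a \<in> univ M" "\<forall>b\<in>univ N. spoiler_wins V M N (k, ps @ [(a, b)], Begin)"
      \<comment> \<open>The type of Spoiler's \<open>a\<close> is realised in \<open>M\<close>, by
        \<open>a\<close> itself, but by no \<open>b\<close> in \<open>N\<close>.\<close>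
      then show ?thesis
        using EI[of "type_in S1 M (?xs @ [a])"] type_in_subset d1 by metis
    next
      fix b
      assume "b \<in> univ N" "\<forall>a\<in>univ M. spoiler_wins V M N (k, ps @ [(a, b)], Begin)"
      then show ?thesis
        using EI[of "type_in S1 N (?ys @ [b])"] type_in_subset d1 by metis
    next
      fix i j A
      assume TcM: "i < m" "j < m" "A \<in> adm M" "fst (ps ! i) \<in> A" "fst (ps ! j) \<notin> A"
        "\<forall>B\<in>adm N. snd (ps ! i) \<in> B \<longrightarrow> snd (ps ! j) \<notin> B \<longrightarrow>
        (\<exists>b'\<in>B. \<exists>b''\<in>univ N - B. \<forall>a'\<in>A. \<forall>a''\<in>univ M - A.
          spoiler_wins V M N (k, ps @ [(a', b'), (a'', b'')], Begin))"
      \<comment> \<open>The types realised by pairs that leave Spoiler's set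
        \<open>A\<close>.\<close>
      define \<Theta> where "\<Theta> = (\<lambda>(a', a''). type_in S2 M (?xs @ [a', a''])) ` (A \<times> (univ M - A))"
      \<comment> \<open>Every separating \<open>B\<close> is left by an edge: Spoiler's next choice
        \<open>b'\<close>, \<open>b''\<close> wins against all pairs crossing \<open>A\<close>, so
        its type is not in \<open>\<Theta>\<close>.\<close>
      have win: "?PN \<Theta> i j"
      proof (intro ballI impI)
        fix B assume B: "B \<in> adm N" "snd (ps ! i) \<in> B" "snd (ps ! j) \<notin> B"
        from TcM(6)[rule_format, OF B] obtain b' b'' where b: "b' \<in> B" "b'' \<in> univ N - B"
          and next_win: "\<forall>a'\<in>A. \<forall>a''\<in>univ M - A.
            spoiler_wins V M N (k, ps @ [(a', b'), (a'', b'')], Begin)"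
          by (elim bexE) (rule that)
        have "type_in S2 M (?xs @ [a', a'']) \<noteq> type_in S2 N (?ys @ [b', b''])"
          if "a' \<in> A" "a'' \<in> univ M - A" for a' a''
          by (rule d2) (use that b adm(1)[OF TcM(3)] adm(2)[OF B(1)] next_win in auto)
        then have "type_in S2 N (?ys @ [b', b'']) \<notin> \<Theta>"
          by (fastforce simp: \<Theta>_def)
        with b show "\<exists>b'\<in>B. \<exists>b''\<in>univ N - B. type_in S2 N (?ys @ [b', b'']) \<notin> \<Theta>"
          by blast
      qed
      \<comment> \<open>\<open>A\<close> itself refutes the closure in \<open>M\<close>, since by
        the choice of \<open>\<Theta>\<close> no edge leaves it.\<close>
      have lose: "\<not> ?PM \<Theta> i j"
      proof
        assume "?PM \<Theta> i j"
        from this[rule_format, OF TcM(3-5)] show False by (auto simp: \<Theta>_def)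
      qed
      have \<Theta>: "\<Theta> \<subseteq> Pow S2" using type_in_subset by (force simp: \<Theta>_def)
      show ?thesis
        by (rule CI[OF \<Theta> TcM(1,2) neq[OF lose win]])
    next
      fix i j B
      assume TcN: "i < m" "j < m" "B \<in> adm N" "snd (ps ! i) \<in> B" "snd (ps ! j) \<notin> B"
        "\<forall>A\<in>adm M. fst (ps ! i) \<in> A \<longrightarrow> fst (ps ! j) \<notin> A \<longrightarrow>
        (\<exists>a'\<in>A. \<exists>a''\<in>univ M - A. \<forall>b'\<in>B. \<forall>b''\<in>univ N - B.
          spoiler_wins V M N (k, ps @ [(a', b'), (a'', b'')], Begin))"
      \<comment> \<open>With the roles exchanged, the closure formula holds in \<open>M\<close> and
        is refuted by Spoiler's \<open>B\<close> in \<open>N\<close>.\<close>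
      define \<Theta> where "\<Theta> = (\<lambda>(b', b''). type_in S2 N (?ys @ [b', b''])) ` (B \<times> (univ N - B))"
      have win: "?PM \<Theta> i j"
      proof (intro ballI impI)
        fix A assume A: "A \<in> adm M" "fst (ps ! i) \<in> A" "fst (ps ! j) \<notin> A"
        from TcN(6)[rule_format, OF A] obtain a' a'' where a: "a' \<in> A" "a'' \<in> univ M - A"
          and next_win: "\<forall>b'\<in>B. \<forall>b''\<in>univ N - B.
            spoiler_wins V M N (k, ps @ [(a', b'), (a'', b'')], Begin)"
          by (elim bexE) (rule that)
        have "type_in S2 M (?xs @ [a', a'']) \<noteq> type_in S2 N (?ys @ [b', b''])"
          if "b' \<in> B" "b'' \<in> univ N - B" for b' b''
          by (rule d2) (use that a adm(1)[OF A(1)] adm(2)[OF TcN(3)] next_win in auto)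
        then have "type_in S2 M (?xs @ [a', a'']) \<notin> \<Theta>"
          by (fastforce simp: \<Theta>_def)
        with a show "\<exists>a'\<in>A. \<exists>a''\<in>univ M - A. type_in S2 M (?xs @ [a', a'']) \<notin> \<Theta>"
          by blast
      qed
      have lose: "\<not> ?PN \<Theta> i j"
      proof
        assume "?PN \<Theta> i j"
        from this[rule_format, OF TcN(3-5)] show False by (auto simp: \<Theta>_def)
      qed
      have \<Theta>: "\<Theta> \<subseteq> Pow S2" using type_in_subset by (force simp: \<Theta>_def)
      show ?thesis
        by (rule CI[OF \<Theta> TcN(1,2) neq[OF lose win, symmetric]])
    qed
  qed
  ultimately show ?case by (intro exI[of _ "E \<union> C"]) blast
qed

section \<open>Winning strategies and distinguishing formulas of exact depth\<close>

theorem theorem5p18: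
  fixes V :: "'r vocab" and M :: "('r, 'a) frame" and N :: "('r, 'b) frame"
    and as :: "'a list" and bs :: "'b list" and s n :: nat
  assumes "finite (syms V)"
    and "henkin_structure V M" and "henkin_structure V N"
    and "length as = s" and "set as \<subseteq> univ M"
    and "length bs = s" and "set bs \<subseteq> univ N"
  shows "spoiler_wins_EF V n M as N bs \<longleftrightarrow>
    (\<exists>\<phi>. wf_fm V \<phi> \<and> fv \<phi> \<subseteq> {..<s} \<and> qdepth \<phi> = n \<and> distinguishes \<phi> M as N bs)"
proof -
  have frames: "is_frame V M" "is_frame V N"
    using assms(2,3) by (auto simp: henkin_structure_def)
  let ?ps = "zip as bs"
  have ps: "set ?ps \<subseteq> univ M \<times> univ N" "length ?ps = s" "map fst ?ps = as" "map snd ?ps = bs"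
    using assms(4-7) by (auto dest: set_zip_leftD set_zip_rightD)
  have dist: "distinguishes \<phi> M as N bs \<longleftrightarrow> sat M (env as) \<phi> \<noteq> sat N (env bs) \<phi>"
    if "fv \<phi> \<subseteq> {..<s}" for \<phi>
    using distinguishes_iff_sat_env[OF frames(1) assms(5) _ frames(2) assms(7)] that assms(4,6)
    by auto
  show ?thesis unfolding spoiler_wins_EF_iff
  proof
    assume "spoiler_wins V M N (n, ?ps, Begin)"
    moreover obtain S where "S \<subseteq> bounded_fms V n s"
      "\<forall>ps. length ps = s \<and> set ps \<subseteq> univ M \<times> univ N \<and> spoiler_wins V M N (n, ps, Begin) \<longrightarrow>
        type_in S M (map fst ps) \<noteq> type_in S N (map snd ps)"
      using spoiler_wins_imp_distinguishes[OF frames assms(1), of n s]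
      by (elim exE conjE) (rule that)
    ultimately have "S \<subseteq> bounded_fms V n s" "type_in S M as \<noteq> type_in S N bs"
      using ps by (metis, metis)
    then obtain \<phi> where \<phi>: "\<phi> \<in> bounded_fms V n s" "sat M (env as) \<phi> \<noteq> sat N (env bs) \<phi>"
      unfolding type_in_eq_iff by blast
    \<comment> \<open>\<open>\<phi>\<close> may be shallower than \<open>n\<close>; vacuous
      quantifiers over the non-free variable \<open>s\<close> make up the difference, keeping its
      truth value since both universes are nonempty.\<close>
    define \<psi> where "\<psi> = (Ex s ^^ (n - qdepth \<phi>)) \<phi>"
    have "univ M \<noteq> {}" "univ N \<noteq> {}" using frames by (auto simp: is_frame_def)
    then have "sat M (env as) \<psi> \<noteq> sat N (env bs) \<psi>"
      using \<phi> by (simp add: \<psi>_def sat_pad)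
    moreover have "wf_fm V \<psi>" "fv \<psi> \<subseteq> {..<s}" "qdepth \<psi> = n"
      using pad_bounded[OF \<phi>(1), of "n - qdepth \<phi>"] \<phi>(1) by (auto simp: \<psi>_def bounded_fms_def)
    ultimately show "\<exists>\<phi>. wf_fm V \<phi> \<and> fv \<phi> \<subseteq> {..<s} \<and> qdepth \<phi> = n \<and> distinguishes \<phi> M as N bs"
      using dist by blast
  next
    assume "\<exists>\<phi>. wf_fm V \<phi> \<and> fv \<phi> \<subseteq> {..<s} \<and> qdepth \<phi> = n \<and> distinguishes \<phi> M as N bs"
    then obtain \<phi> where \<phi>: "wf_fm V \<phi>" "fv \<phi> \<subseteq> {..<s}" "qdepth \<phi> = n"
      "sat M (env as) \<phi> \<noteq> sat N (env bs) \<phi>"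
      using dist by blast
    \<comment> \<open>Initially variable \<open>v\<close> is carried by the pebble pair at position
      \<open>v\<close>.\<close>
    have "(env as v, env bs v) \<in> set ?ps" if "v \<in> fv \<phi>" for v
      using that \<phi>(2) assms(4,6) by (auto simp: env_def set_zip)
    then show "spoiler_wins V M N (n, ?ps, Begin)"
      using distinguishes_imp_spoiler_wins[OF frames ps(1) \<phi>(1)] \<phi>(3,4) by auto
  qed
qed

end
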